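(* If $m\ge 2$ and $n\ge 3$, then $\chi_{\rho}(P_m, K_{1,n})=3$ and $\widehat{\chi}_{\rho}(P_m, K_{1,n})\le 9$. Moreover, if $n=3$ and $m\ge 10$, then $\widehat{\chi}_{\rho}(P_m, K_{1,n})\in\{6,7,8,9\}$, and if $n>3$ and $m\ge 35$, then $\widehat{\chi}_{\rho}(P_m, K_{1,n})\in\{7,8,9\}$.
   Context: For graphs $G$ and $H$ and a function $f\colon V(G)\to V(H)$, the Sierpiński product $G\otimes_f H$ is the graph with vertex set $V(G)\times V(H)$ whose edges are: $(g,h)(g,h')$ for every $g\in V(G)$ and every edge $hh'\in E(H)$; and $(g,f(g'))(g',f(g))$ for every edge $gg'\in E(G)$. Let $H^G$ denote the set of all functions $V(G)\to V(H)$. For a graph $X$, a packing $k$-coloring is a map $c\colon V(X)\to\{1,\dots,k\}$ such that whenever $u\neq v$ and $c(u)=c(v)=\ell$, the shortest-path distance satisfies $d_X(u,v)>\ell$; the packing chromatic number $\chi_\rho(X)$ is the least $k$ for which a packing $k$-coloring exists. The Sierpiński packing chromatic number of $(G,H)$ is $\chi_\rho(G,H)=\min_{f\in H^G}\chi_\rho(G\otimes_f H)$ and the upper one is $\widehat{\chi}_\rho(G,H)=\max_{f\in H^G}\chi_\rho(G\otimes_f H)$. $K_{1,n}$ is the star with $n$ leaves and $P_m$ the path on $m$ vertices. *)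

theory Defs
  imports
    "HOL-Library.FuncSet"
    "Graph_Theory.Pair_Digraph"
    "Graph_Theory.Shortest_Path"
begin

text \<open>A finite simple graph is a \<^locale>\<open>pair_graph\<close>: an edge \<open>uv\<close> is the pair of arcs
  \<open>(u, v)\<close> and \<open>(v, u)\<close>.\<close>

definition path_graph :: "nat \<Rightarrow> nat pair_pre_digraph" where
  "path_graph m = \<lparr> pverts = {1..m},
     parcs = {(i, j). i \<in> {1..m} \<and> j \<in> {1..m} \<and> (j = Suc i \<or> i = Suc j)} \<rparr>"

text \<open>Vertex \<open>0\<close> is the centre of the star, \<open>1, \<dots>, n\<close> are its leaves.\<close>

definition star_graph :: "nat \<Rightarrow> nat pair_pre_digraph" where
  "star_graph n = \<lparr> pverts = {0..n}, parcs = {0} \<times> {1..n} \<union> {1..n} \<times> {0} \<rparr>"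

definition sierpinski_product ::
    "'a pair_pre_digraph \<Rightarrow> ('a \<Rightarrow> 'b) \<Rightarrow> 'b pair_pre_digraph \<Rightarrow> ('a \<times> 'b) pair_pre_digraph" where
  "sierpinski_product G f H = \<lparr> pverts = pverts G \<times> pverts H,
     parcs = {((g, h), (g, h')) | g h h'. g \<in> pverts G \<and> (h, h') \<in> parcs H}
           \<union> {((g, f g'), (g', f g)) | g g'. (g, g') \<in> parcs G} \<rparr>"

text \<open>Shortest-path distance, with value \<open>\<infinity>\<close> between different components.\<close>

definition graph_dist :: "'a pair_pre_digraph \<Rightarrow> 'a \<Rightarrow> 'a \<Rightarrow> ereal" where
  "graph_dist X u v = wf_digraph.\<mu> (with_proj X) (\<lambda>_. 1) u v"

definition packing_coloring :: "'a pair_pre_digraph \<Rightarrow> nat \<Rightarrow> ('a \<Rightarrow> nat) \<Rightarrow> bool" where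
  "packing_coloring X k c \<longleftrightarrow> c \<in> pverts X \<rightarrow> {1..k} \<and>
     (\<forall>u \<in> pverts X. \<forall>v \<in> pverts X. u \<noteq> v \<and> c u = c v \<longrightarrow> graph_dist X u v > ereal (real (c u)))"

definition packing_chromatic_number :: "'a pair_pre_digraph \<Rightarrow> nat" where
  "packing_chromatic_number X = (LEAST k. \<exists>c. packing_coloring X k c)"

text \<open>The set of all functions from \<open>V(G)\<close> to \<open>V(H)\<close> is rendered as the extensional function
  space, which makes it finite for finite \<open>G\<close> and \<open>H\<close>.\<close>

definition sierpinski_packing_values :: "'a pair_pre_digraph \<Rightarrow> 'b pair_pre_digraph \<Rightarrow> nat set" where
  "sierpinski_packing_values G H =
     (\<lambda>f. packing_chromatic_number (sierpinski_product G f H)) ` (pverts G \<rightarrow>\<^sub>E pverts H)"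

definition sierpinski_packing_number :: "'a pair_pre_digraph \<Rightarrow> 'b pair_pre_digraph \<Rightarrow> nat" where
  "sierpinski_packing_number G H = Min (sierpinski_packing_values G H)"

definition upper_sierpinski_packing_number :: "'a pair_pre_digraph \<Rightarrow> 'b pair_pre_digraph \<Rightarrow> nat" where
  "upper_sierpinski_packing_number G H = Max (sierpinski_packing_values G H)"


text \<open>The following facts show that the objects above are simple graphs, and that the
  \<open>INF\<close>, \<open>LEAST\<close>, \<open>Min\<close> and \<open>Max\<close> in the definitions are well defined.\<close>

lemma pair_graphI:
  assumes "finite (pverts G)"
    and "\<And>u v. (u, v) \<in> parcs G \<Longrightarrow> u \<in> pverts G \<and> v \<in> pverts G \<and> u \<noteq> v \<and> (v, u) \<in> parcs G"
  shows "pair_graph G"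
proof -
  have "parcs G \<subseteq> pverts G \<times> pverts G" using assms(2) by auto
  then have "finite (parcs G)"
    by (rule finite_subset) (use assms(1) in simp)
  then show ?thesis
    using assms by unfold_locales (auto simp: symmetric_def sym_def)
qed

lemma pair_graph_path_graph: "pair_graph (path_graph m)"
  by (rule pair_graphI) (auto simp: path_graph_def)

lemma pair_graph_star_graph: "pair_graph (star_graph n)"
  by (rule pair_graphI) (auto simp: star_graph_def)

lemma pair_graph_sierpinski_product:
  assumes "pair_graph G" "pair_graph H" "f \<in> pverts G \<rightarrow> pverts H"
  shows "pair_graph (sierpinski_product G f H)"
proof -
  interpret G: pair_graph G by fact
  interpret H: pair_graph H by fact
  have symG: "(b, a) \<in> parcs G" if "(a, b) \<in> parcs G" for a b
    using G.pair_sym_arcs that by (auto simp: symmetric_def sym_def)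
  have symH: "(b, a) \<in> parcs H" if "(a, b) \<in> parcs H" for a b
    using H.pair_sym_arcs that by (auto simp: symmetric_def sym_def)
  have irrefl: "(a, a) \<notin> parcs G" "(b, b) \<notin> parcs H" for a b
    using G.no_loops' H.no_loops' by blast+
  show ?thesis
    by (rule pair_graphI)
      (use assms(3) G.in_arcsD1 G.in_arcsD2 H.in_arcsD1 H.in_arcsD2 irrefl symG symH
        in \<open>auto simp: sierpinski_product_def G.pair_finite_verts H.pair_finite_verts\<close>)
qed

lemma graph_dist_eq_INF_length:
  assumes "pair_graph X"
  shows "graph_dist X u v = (INF p \<in> {p. pre_digraph.awalk (with_proj X) u p v}. ereal (real (length p)))"
proof -
  interpret X: pair_graph X by fact
  have "X.awalk_cost (\<lambda>_. 1) p = real (length p)" for p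
    by (induction p) auto
  then show ?thesis
    by (simp add: graph_dist_def X.\<mu>_def)
qed

lemma packing_coloring_packing_chromatic_number:
  assumes "finite (pverts X)"
  shows "\<exists>c. packing_coloring X (packing_chromatic_number X) c"
proof -
  obtain c where c: "bij_betw c (pverts X) {1..card (pverts X)}"
    using assms by (metis card_atLeastAtMost diff_Suc_1 finite_atLeastAtMost finite_same_card_bij)
  then have "packing_coloring X (card (pverts X)) c"
    by (auto simp: packing_coloring_def bij_betw_def inj_on_def)
  then show ?thesis
    unfolding packing_chromatic_number_def by (intro LeastI[of "\<lambda>k. \<exists>c. packing_coloring X k c"]) blast
qed

lemma
  assumes "pair_graph G" "pair_graph H" "pverts H \<noteq> {}"
  shows finite_sierpinski_packing_values: "finite (sierpinski_packing_values G H)"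
    and sierpinski_packing_values_nonempty: "sierpinski_packing_values G H \<noteq> {}"
proof -
  interpret G: pair_graph G by fact
  interpret H: pair_graph H by fact
  show "finite (sierpinski_packing_values G H)"
    unfolding sierpinski_packing_values_def
    by (intro finite_imageI finite_PiE G.pair_finite_verts H.pair_finite_verts)
  show "sierpinski_packing_values G H \<noteq> {}"
    using assms(3) by (simp add: sierpinski_packing_values_def PiE_eq_empty_iff)
qed

end

theory Submission
  imports Defs
begin

text \<open>The product \<open>P\<^sub>m \<otimes>\<^sub>f K\<^sub>1\<^sub>,\<^sub>n\<close> is a tree: the copies of the star are strung along a spine, the path
  that runs through the connecting edges. Distances are bounded from below by integer potentials that
  change by at most 1 along every edge.

  Nine colours suffice for every \<open>f\<close>. A copy whose two connecting edges leave from different vertices,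
  or both from the centre, contributes its spine vertices; these are coloured by a fixed periodic
  packing colouring of the integers with the colours 2 to 7, and everything else gets colour 1.
  The delicate copies are those whose two connecting edges leave from a common leaf: then the centre
  hangs off the spine, so it is one step farther from everything. At odd positions the leaf gets
  colour 1 and the centre takes over the colour of the position; at even positions the leaf keeps its
  colour 3 or 2 and the centre gets colour 2, or alternately 8 and 9, respectively.

  The lower bounds come from \<open>f = 0\<close>, a path of centres with \<open>n\<close> leaves attached to each. Inner centres
  have too many neighbours to be coloured 1, so their colours form a packing word over
  \<open>{2..k}\<close>; such words have bounded length, and the longest ones must begin and end with 2, which
  clashes with the way the two ends of the path can be coloured.\<close>

section \<open>Distances and packing colourings\<close>

lemma awalk_with_proj_induct [consumes 2, case_names Nil Cons]:
  assumes "pair_graph X" "pre_digraph.awalk (with_proj X) u p v"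
    and "\<And>u. u \<in> pverts X \<Longrightarrow> P u [] u"
    and "\<And>u w p v. (u, w) \<in> parcs X \<Longrightarrow> pre_digraph.awalk (with_proj X) w p v \<Longrightarrow> P w p v
      \<Longrightarrow> P u ((u, w) # p) v"
  shows "P u p v"
proof -
  interpret X: pair_graph X by fact
  show ?thesis
    using assms(2)
    by (induction p arbitrary: u) (auto simp: X.awalk_Nil_iff X.awalk_Cons_iff intro!: assms(3,4))
qed

lemma graph_dist_le_relpow:
  assumes "pair_graph X" "u \<in> pverts X" "(u, v) \<in> parcs X ^^ l"
  shows "graph_dist X u v \<le> ereal (real l)"
proof -
  interpret X: pair_graph X by fact
  have "\<exists>p. X.awalk u p v \<and> length p = l"
    using assms(2,3)
  proof (induction l arbitrary: u)
    case 0
    then show ?case by (auto simp: X.awalk_Nil_iff intro!: exI[of _ "[]"])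
  next
    case (Suc l)
    from Suc.prems(2) obtain w where w: "(u, w) \<in> parcs X" "(w, v) \<in> parcs X ^^ l"
      by (meson relpow_Suc_D2)
    then obtain p where "X.awalk w p v" "length p = l"
      using Suc.IH X.in_arcsD2 by blast
    with w(1) show ?case
      by (intro exI[of _ "(u, w) # p"]) (auto simp: X.awalk_Cons_iff)
  qed
  then show ?thesis
    unfolding graph_dist_eq_INF_length[OF assms(1)] by (force intro: INF_lower2)
qed

text \<open>Adding up the hypothesis along a walk bounds its length from below, and the infimum over
  all walks inherits the bound. An explicit potential thus replaces the search for shortest
  paths.\<close>

lemma graph_dist_ge_Lipschitz:
  fixes \<phi> :: "'a \<Rightarrow> int"
  assumes "pair_graph X" and Lip: "\<And>a b. (a, b) \<in> parcs X \<Longrightarrow> \<phi> a \<le> \<phi> b + 1"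
    and "d \<le> \<phi> u - \<phi> v"
  shows "graph_dist X u v \<ge> ereal (real_of_int d)"
  unfolding graph_dist_eq_INF_length[OF assms(1)]
proof (rule INF_greatest)
  fix p assume "p \<in> {p. pre_digraph.awalk (with_proj X) u p v}"
  then have "pre_digraph.awalk (with_proj X) u p v" by simp
  with assms(1) have "\<phi> u \<le> \<phi> v + int (length p)"
  proof (induction rule: awalk_with_proj_induct)
    case (Cons u w p v)
    then show ?case using Lip[of u w] by simp
  qed simp
  with assms(3) have "real_of_int d \<le> real_of_int (int (length p))" by linarith
  then show "ereal (real_of_int d) \<le> ereal (real (length p))" by simp
qed

lemma graph_dist_gt_1:
  assumes "pair_graph X" "u \<noteq> v" "(u, v) \<notin> parcs X"
  shows "graph_dist X u v > ereal 1"
proof -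
  interpret X: pair_graph X by fact
  have sym: "(b, a) \<in> parcs X" if "(a, b) \<in> parcs X" for a b
    using X.pair_sym_arcs that by (auto simp: symmetric_def sym_def)
  \<comment> \<open>The potential is the distance to \<open>v\<close>, cut off at 2.\<close>
  define \<phi> :: "'a \<Rightarrow> int" where "\<phi> w = (if w = v then 0 else if (w, v) \<in> parcs X then 1 else 2)" for w
  have "graph_dist X u v \<ge> ereal (real_of_int 2)"
    by (rule graph_dist_ge_Lipschitz[OF assms(1), of \<phi>]) (use assms(2,3) sym in \<open>auto simp: \<phi>_def\<close>)
  moreover have "ereal 1 < ereal (real_of_int 2)" by simp
  ultimately show ?thesis by (rule order_less_le_trans[rotated])
qed

lemma packing_coloring_mono:
  "packing_coloring X k c \<Longrightarrow> k \<le> k' \<Longrightarrow> packing_coloring X k' c"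
  unfolding packing_coloring_def by fastforce

lemma packing_chromatic_number_le:
  "packing_coloring X k c \<Longrightarrow> packing_chromatic_number X \<le> k"
  unfolding packing_chromatic_number_def by (auto intro: Least_le)

lemma packing_chromatic_number_gt:
  assumes "finite (pverts X)" "\<And>c. \<not> packing_coloring X k c"
  shows "k < packing_chromatic_number X"
  using packing_coloring_packing_chromatic_number[OF assms(1)] assms(2) packing_coloring_mono
  by (metis linorder_not_le)

text \<open>The form in which colourings are refuted: a short walk, given as a relation power,
  forbids a common colour.\<close>

lemma packing_coloring_neq:
  assumes "packing_coloring X k c" "pair_graph X" "u \<in> pverts X" "v \<in> pverts X" "u \<noteq> v"
    and "(u, v) \<in> parcs X ^^ l" "l \<le> c u"
  shows "c u \<noteq> c v"
proof
  assume "c u = c v"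
  then have "graph_dist X u v > ereal (real (c u))"
    using assms unfolding packing_coloring_def by blast
  moreover have "graph_dist X u v \<le> ereal (real l)"
    by (rule graph_dist_le_relpow[OF assms(2,3,6)])
  ultimately have "ereal (real (c u)) < ereal (real l)" by (rule order_less_le_trans)
  then show False using assms(7) by simp
qed

section \<open>The product of a path and a star\<close>

abbreviation path_star :: "nat \<Rightarrow> nat \<Rightarrow> (nat \<Rightarrow> nat) \<Rightarrow> (nat \<times> nat) pair_pre_digraph" where
  "path_star m n f \<equiv> sierpinski_product (path_graph m) f (star_graph n)"

lemma pverts_path_star: "pverts (path_star m n f) = {1..m} \<times> {0..n}"
  by (simp add: sierpinski_product_def path_graph_def star_graph_def)

lemma arc_path_star_iff:
  "((i, h), (j, h')) \<in> parcs (path_star m n f) \<longleftrightarrow>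
    i \<in> {1..m} \<and> j \<in> {1..m} \<and>
    (i = j \<and> h \<le> n \<and> h' \<le> n \<and> (h = 0) \<noteq> (h' = 0) \<or>
     (j = Suc i \<or> i = Suc j) \<and> h = f j \<and> h' = f i)"
  by (auto simp: sierpinski_product_def path_graph_def star_graph_def)

lemma arc_path_star_sym:
  "(u, v) \<in> parcs (path_star m n f) \<Longrightarrow> (v, u) \<in> parcs (path_star m n f)"
  by (cases u; cases v) (auto simp: arc_path_star_iff)

lemma pair_graph_path_star:
  assumes "f \<in> {1..m} \<rightarrow> {0..n}"
  shows "pair_graph (path_star m n f)"
  by (rule pair_graph_sierpinski_product[OF pair_graph_path_graph pair_graph_star_graph])
    (use assms in \<open>simp add: path_graph_def star_graph_def\<close>)

section \<open>Three colours\<close>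

text \<open>With this \<open>f\<close> every connecting edge joins the centre of an odd copy to leaf
  1 or 2 of an even copy, and the two leaves used in an even copy differ. Leaves are then
  independent and take colour 1. Consecutive centres are 2 apart, so alternating 2 and 3 repeats a
  colour at distance 4 at the earliest.\<close>

lemma packing_coloring_3_path_star:
  assumes "n \<ge> 2"
  shows "\<exists>f \<in> {1..m} \<rightarrow>\<^sub>E {0..n}. \<exists>c. packing_coloring (path_star m n f) 3 c"
proof -
  define f :: "nat \<Rightarrow> nat" where
    "f = (\<lambda>i\<in>{1..m}. if even i then 0 else if i mod 4 = 1 then 1 else 2)"
  define c :: "nat \<times> nat \<Rightarrow> nat" where
    "c = (\<lambda>(i, h). if h \<noteq> 0 then 1 else if even i then 2 else 3)"
  \<comment> \<open>Position along the spine: the centre of copy \<open>i\<close> sits at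
    \<open>2 * i\<close>, and in an even copy the leaf towards the previous copy comes one before
    it, the leaf towards the next copy one after. All other leaves share the value of their
    centre.\<close>
  define \<phi> :: "nat \<times> nat \<Rightarrow> int" where
    "\<phi> = (\<lambda>(i, h). 2 * int i +
      (if odd i \<or> h \<notin> {1, 2} then 0 else if (h = 1) = (i mod 4 = 2) then -1 else 1))"
  have f: "f \<in> {1..m} \<rightarrow>\<^sub>E {0..n}"
    using assms by (auto simp: f_def)
  then have pg: "pair_graph (path_star m n f)"
    by (intro pair_graph_path_star) auto
  have f_Suc: "f (Suc i) = 0 \<or> f i = 0" if "Suc i \<in> {1..m}" "i \<in> {1..m}" for i
    using that by (simp add: f_def)
  have \<phi>_star: "\<phi> (i, 0) = 2 * int i" "\<bar>\<phi> (i, h) - 2 * int i\<bar> \<le> 1" for i h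
    by (simp_all add: \<phi>_def)
  have \<phi>_Suc: "\<phi> (Suc i, f i) = \<phi> (i, f (Suc i)) + 1"
    if "Suc i \<in> {1..m}" "i \<in> {1..m}" for i
  proof -
    consider "i mod 4 = 0" | "i mod 4 = 1" | "i mod 4 = 2" | "i mod 4 = 3" by linarith
    then show ?thesis
    proof cases
      case 1
      then have "Suc i mod 4 = 1" "even i" by presburger+
      with 1 that show ?thesis by (simp add: f_def \<phi>_def)
    next
      case 2
      then have "Suc i mod 4 = 2" "odd i" by presburger+
      with 2 that show ?thesis by (simp add: f_def \<phi>_def)
    next
      case 3
      then have "Suc i mod 4 = 3" "even i" by presburger+
      with 3 that show ?thesis by (simp add: f_def \<phi>_def)
    next
      case 4
      then have "Suc i mod 4 = 0" "odd i" by presburger+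
      with 4 that show ?thesis by (simp add: f_def \<phi>_def)
    qed
  qed
  have \<phi>: "\<phi> a \<le> \<phi> b + 1" if "(a, b) \<in> parcs (path_star m n f)" for a b
  proof -
    obtain i h j h' where ab: "a = (i, h)" "b = (j, h')" by (metis prod.exhaust)
    from that[unfolded ab arc_path_star_iff] show ?thesis
      using \<phi>_Suc[of i] \<phi>_Suc[of j] \<phi>_star(1)[of i] \<phi>_star(2)[of i h] \<phi>_star(2)[of i h']
      unfolding ab by auto
  qed
  have "packing_coloring (path_star m n f) 3 c"
    unfolding packing_coloring_def
  proof (intro conjI ballI impI; (elim conjE)?)
    show "c \<in> pverts (path_star m n f) \<rightarrow> {1..3}" by (auto simp: c_def)
    fix u v assume u: "u \<in> pverts (path_star m n f)" and v: "v \<in> pverts (path_star m n f)"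
      and "u \<noteq> v" and eq: "c u = c v"
    obtain i h j h' where uv: "u = (i, h)" "v = (j, h')" by (metis prod.exhaust)
    show "ereal (real (c u)) < graph_dist (path_star m n f) u v"
    proof (cases "h = 0")
      case True
      with eq uv have "h' = 0" "even i = even j" and c: "c u \<le> 3"
        by (auto simp: c_def split: if_splits)
      with uv \<open>u \<noteq> v\<close> True have "i \<noteq> j" by auto
      with \<open>even i = even j\<close> have ij: "i + 2 \<le> j \<or> j + 2 \<le> i" by presburger
      have \<phi>uv: "\<phi> u = 2 * int i" "\<phi> v = 2 * int j"
        using uv True \<open>h' = 0\<close> \<phi>_star(1) by auto
      have "graph_dist (path_star m n f) u v \<ge> ereal (real_of_int 4)"
        using ij
      proof
        assume "i + 2 \<le> j"
        then show ?thesis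
          proof (intro graph_dist_ge_Lipschitz[OF pg, of "\<lambda>w. - \<phi> w"])
            show "- \<phi> a \<le> - \<phi> b + 1" if "(a, b) \<in> parcs (path_star m n f)" for a b
              using \<phi>[OF arc_path_star_sym[OF that]] by simp
            show "4 \<le> - \<phi> u - - \<phi> v" using \<phi>uv \<open>i + 2 \<le> j\<close> by simp
          qed
      next
        assume "j + 2 \<le> i"
        then show ?thesis
            using \<phi> \<phi>uv by (intro graph_dist_ge_Lipschitz[OF pg, of \<phi>]) auto
      qed
      moreover have "ereal (real (c u)) < ereal (real_of_int 4)" using c by simp
      ultimately show ?thesis by (rule order_less_le_trans[rotated])
    next
      case False
      with eq uv have "h' \<noteq> 0" and c: "c u = 1" by (auto simp: c_def split: if_splits)
      then have "(u, v) \<notin> parcs (path_star m n f)"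
        using uv False f_Suc[of i] f_Suc[of j] by (auto simp: arc_path_star_iff)
      then show ?thesis
        using graph_dist_gt_1[OF pg \<open>u \<noteq> v\<close>] c by simp
    qed
  qed
  with f show ?thesis by blast
qed

text \<open>The edge between the first two copies extends to a path on four vertices. Two colours
  would have to alternate there, which puts colour 2 on two vertices joined by a walk of length
  2.\<close>

lemma no_packing_coloring_2_path_star:
  assumes "m \<ge> 2" "n \<ge> 1" "f \<in> {1..m} \<rightarrow> {0..n}"
  shows "\<not> packing_coloring (path_star m n f) 2 c"
proof
  assume c: "packing_coloring (path_star m n f) 2 c"
  let ?R = "parcs (path_star m n f)"
  note pg = pair_graph_path_star[OF assms(3)]
  have f: "f 1 \<le> n" "f 2 \<le> n" using assms(1) funcset_mem[OF assms(3), of 1] funcset_mem[OF assms(3), of 2] by auto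
  \<comment> \<open>A further neighbour of each end of the connecting edge: the centre if that end
    is a leaf, otherwise leaf 1.\<close>
  define p q where "p = (if f 2 = 0 then 1 else 0 :: nat)" and "q = (if f 1 = 0 then 1 else 0 :: nat)"
  have pq: "p \<le> n" "q \<le> n" using assms(2) by (auto simp: p_def q_def)
  have arcs: "((1, p), (1, f 2)) \<in> ?R" "((1, f 2), (2, f 1)) \<in> ?R" "((2, f 1), (2, q)) \<in> ?R"
    using assms(1,2) f by (auto simp: arc_path_star_iff p_def q_def)
  have verts: "(1, p) \<in> pverts (path_star m n f)" "(1, f 2) \<in> pverts (path_star m n f)"
    "(2, f 1) \<in> pverts (path_star m n f)" "(2, q) \<in> pverts (path_star m n f)"
    using f pq assms(1) by (auto simp: pverts_path_star)
  have ran: "c x = 1 \<or> c x = 2" if "x \<in> pverts (path_star m n f)" for x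
    using c that unfolding packing_coloring_def by (fastforce dest: funcset_mem)
  have adj: "c x \<noteq> c y" if "(x, y) \<in> ?R" "x \<in> pverts (path_star m n f)" "y \<in> pverts (path_star m n f)" "x \<noteq> y" for x y
    using packing_coloring_neq[OF c pg that(2,3,4), of 1] ran[OF that(2)] that(1) by auto
  have dist2: "c x \<noteq> 2 \<or> c y \<noteq> 2" if "(x, z) \<in> ?R" "(z, y) \<in> ?R"
    "x \<in> pverts (path_star m n f)" "y \<in> pverts (path_star m n f)" "x \<noteq> y" for x y z
  proof -
    have "(x, y) \<in> ?R ^^ 2" using that(1,2) by (auto simp: numeral_2_eq_2)
    then show ?thesis using packing_coloring_neq[OF c pg that(3,4,5)] by fastforce
  qed
  have "c (1, p) \<noteq> c (1, f 2)" "c (1, f 2) \<noteq> c (2, f 1)" "c (2, f 1) \<noteq> c (2, q)"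
    using adj arcs verts by (auto simp: p_def q_def)
  moreover have "c (1, p) \<noteq> 2 \<or> c (2, f 1) \<noteq> 2" "c (1, f 2) \<noteq> 2 \<or> c (2, q) \<noteq> 2"
    using dist2[OF arcs(1,2)] dist2[OF arcs(2,3)] verts by auto
  ultimately show False using ran[OF verts(1)] ran[OF verts(2)] ran[OF verts(3)] ran[OF verts(4)] by argo
qed

section \<open>Nine colours\<close>

definition star_dist :: "nat \<Rightarrow> nat \<Rightarrow> nat" where
  "star_dist a b = (if a = b then 0 else if a = 0 \<or> b = 0 then 1 else 2)"

text \<open>The vertex nearest to \<open>h\<close> on the geodesic from \<open>a\<close> to
  \<open>b\<close>, which runs through the centre whenever \<open>a\<close> and \<open>b\<close>
  differ.\<close>

definition star_proj :: "nat \<Rightarrow> nat \<Rightarrow> nat \<Rightarrow> nat" where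
  "star_proj a b h = (if h = a \<or> h = b then h else if a = b then a else 0)"

text \<open>The copy of the star over \<open>i\<close> is entered at \<open>g (i - 1)\<close> and left at \<open>g (i + 1)\<close>; the
  geodesics between these vertices, together with the connecting edges, form the spine of the tree.
  A vertex is described by the position on the spine of the spine vertex closest to it and by its
  distance (depth) from the spine.\<close>

definition spine_start :: "(nat \<Rightarrow> nat) \<Rightarrow> nat \<Rightarrow> nat" where
  "spine_start g i = (\<Sum>j<i. Suc (star_dist (g (j - 1)) (g (j + 1))))"

definition spine_pos :: "(nat \<Rightarrow> nat) \<Rightarrow> nat \<times> nat \<Rightarrow> nat" where
  "spine_pos g = (\<lambda>(i, h). spine_start g i + star_dist (g (i - 1)) (star_proj (g (i - 1)) (g (i + 1)) h))"

definition spine_depth :: "(nat \<Rightarrow> nat) \<Rightarrow> nat \<times> nat \<Rightarrow> nat" where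
  "spine_depth g = (\<lambda>(i, h). star_dist h (star_proj (g (i - 1)) (g (i + 1)) h))"

definition shared :: "(nat \<Rightarrow> nat) \<Rightarrow> nat \<Rightarrow> bool" where
  "shared g i \<longleftrightarrow> g (i - 1) = g (i + 1) \<and> g (i + 1) \<noteq> 0"

text \<open>Each colour occupies a single residue class modulo 4, 6 or 12, and the modulus exceeds
  the colour. Even positions carry 2 and 3, odd ones 4 to 7.\<close>

definition line_color :: "nat \<Rightarrow> nat" where
  "line_color t = (if t mod 4 = 0 then 2 else if t mod 4 = 2 then 3
     else if t mod 6 = 1 then 4 else if t mod 6 = 3 then 5 else if t mod 12 = 5 then 6 else 7)"

text \<open>When \<open>s\<close> holds, depth 0 is the common leaf, depth 1 the centre and depth 2
  any other leaf. Centres avoid colour 1, so that all leaves off the spine can share it.\<close>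

definition spine_color :: "bool \<Rightarrow> nat \<Rightarrow> nat \<Rightarrow> nat" where
  "spine_color s d t =
    (if s then
       if d = 0 then if odd t then 1 else line_color t
       else if d = 1 then
         if odd t then line_color t else if t mod 4 = 2 then 2 else if t mod 8 = 0 then 8 else 9
       else 1
     else if d = 0 then line_color t else 1)"

lemma line_color_bounds: "2 \<le> line_color t" "line_color t \<le> 7"
  by (auto simp: line_color_def)

lemma spine_color_bounds: "1 \<le> spine_color s d t" "spine_color s d t \<le> 9"
  using line_color_bounds[of t] by (auto simp: spine_color_def)

text \<open>Only colour 2 is spread over two residue classes. For 2, 8 and 9 the depth is recorded
  as well, since residues alone leave too small a gap.\<close>

lemma spine_color_eqD:
  assumes "spine_color s d t = k" "k \<ge> 2"
  shows "k = 2 \<and> t mod 4 = 0 \<and> d = 0 \<or> k = 2 \<and> t mod 4 = 2 \<and> d = 1 \<or> k = 3 \<and> t mod 4 = 2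
    \<or> k = 4 \<and> t mod 6 = 1 \<or> k = 5 \<and> t mod 6 = 3 \<or> k = 6 \<and> t mod 12 = 5 \<or> k = 7 \<and> t mod 12 = 11
    \<or> k = 8 \<and> t mod 8 = 0 \<and> d = 1 \<or> k = 9 \<and> t mod 8 = 4 \<and> d = 1"
proof -
  \<comment> \<open>Opaque names for the residues keep arithmetic on \<open>mod\<close> out of the
    case splits; the relations needed between them are supplied as separate facts.\<close>
  obtain x4 x6 x8 x12 where x: "t mod 4 = x4" "t mod 6 = x6" "t mod 8 = x8" "t mod 12 = x12" by blast
  have "t mod 4 = 0 \<or> t mod 4 = 2 \<longleftrightarrow> even t" by presburger
  moreover have "t mod 12 = 11" if "odd t" "t mod 6 \<noteq> 1" "t mod 6 \<noteq> 3" "t mod 12 \<noteq> 5"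
    using that by presburger
  moreover have "t mod 8 = 4" if "t mod 4 = 0" "t mod 8 \<noteq> 0"
    using that by presburger
  moreover have "t mod 4 = 0" if "t mod 8 = 0"
    using that by presburger
  ultimately show ?thesis
    using assms unfolding spine_color_def line_color_def x
    by (simp split: if_splits)
qed

text \<open>For most colours the modulus alone suffices. The exceptions draw on depth: a 2 at
  residue 0 and a 2 at residue 2 modulo 4 are at least 2 positions apart and one of them has depth
  1; two 8s or two 9s are at least 8 apart, both at depth 1, which gives 10.\<close>

lemma spine_color_packing:
  assumes "spine_color s d t = k" "spine_color s' d' t' = k" "k \<ge> 2" "t < t'"
  shows "k < t' - t + d + d'"
proof -
  have gap: "t + r \<le> t'" if "t mod r = t' mod r" for r
  proof -
    have "r dvd t' - t" using that assms(4) by (metis mod_eq_dvd_iff_nat order_less_imp_le)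
    then have "r \<le> t' - t" using assms(4) by (intro dvd_imp_le) auto
    then show ?thesis using assms(4) by linarith
  qed
  have gap2: "t + 2 \<le> t'" if "t mod 4 = 0 \<and> t' mod 4 = 2 \<or> t mod 4 = 2 \<and> t' mod 4 = 0"
    using that assms(4) by presburger
  obtain x4 x6 x8 x12 y4 y6 y8 y12
    where x: "t mod 4 = x4" "t mod 6 = x6" "t mod 8 = x8" "t mod 12 = x12"
      "t' mod 4 = y4" "t' mod 6 = y6" "t' mod 8 = y8" "t' mod 12 = y12" by blast
  show ?thesis
    using spine_color_eqD[OF assms(1,3)] spine_color_eqD[OF assms(2,3)] assms(4)
      gap[of 4] gap[of 6] gap[of 8] gap[of 12] gap2
    unfolding x by (elim disjE conjE; simp)
qed

text \<open>Meant for two vertices of one copy, hence the common \<open>s\<close>. At a fixed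
  position the colours at depths 0 and 1 differ, and all greater depths get colour 1.\<close>

lemma spine_color_eq_depth:
  assumes "spine_color s d t = spine_color s d' t" "spine_color s d t \<ge> 2"
  shows "d = d'" "d \<le> 1" "d = 1 \<Longrightarrow> s"
proof -
  obtain x4 x6 x8 x12 where x: "t mod 4 = x4" "t mod 6 = x6" "t mod 8 = x8" "t mod 12 = x12" by blast
  have "t mod 4 = 0 \<or> t mod 4 = 2 \<longleftrightarrow> even t" by presburger
  then show "d = d'" using assms
    unfolding spine_color_def line_color_def x by (simp split: if_splits)
  show "d \<le> 1" "d = 1 \<Longrightarrow> s" using assms by (auto simp: spine_color_def split: if_splits)
qed

lemma spine_start_Suc: "spine_start g (Suc i) = spine_start g i + Suc (star_dist (g (i - 1)) (g (i + 1)))"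
  by (simp add: spine_start_def)

lemma spine_start_mono: "i \<le> j \<Longrightarrow> spine_start g i \<le> spine_start g j"
  unfolding spine_start_def by (intro sum_mono2) auto

lemma spine_pos_less:
  assumes "i < j"
  shows "spine_pos g (i, h) < spine_pos g (j, h')"
proof -
  have "spine_pos g (i, h) < spine_start g (Suc i)"
    by (auto simp: spine_pos_def spine_start_Suc star_dist_def star_proj_def)
  also have "\<dots> \<le> spine_start g j" using assms by (intro spine_start_mono) simp
  also have "\<dots> \<le> spine_pos g (j, h')" by (simp add: spine_pos_def)
  finally show ?thesis .
qed

text \<open>On the spine the position determines the vertex. At depth 1 this remains true in shared
  copies, where only the centre has that depth; elsewhere the leaves off the spine all have equal
  coordinates.\<close>

lemma spine_coordinates_inj:
  assumes "spine_pos g (i, h) = spine_pos g (i, h')" "spine_depth g (i, h) = spine_depth g (i, h')"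
    and "spine_depth g (i, h) \<le> 1" "spine_depth g (i, h) = 1 \<Longrightarrow> shared g i"
  shows "h = h'"
proof -
  obtain a b where ab: "g (i - 1) = a" "g (i + 1) = b" by blast
  let ?p = "star_proj a b"
  have pos: "star_dist a (?p h) = star_dist a (?p h')"
    and depth: "star_dist h (?p h) = star_dist h' (?p h')" "star_dist h (?p h) \<le> 1"
    and sh: "star_dist h (?p h) = 1 \<Longrightarrow> a = b \<and> b \<noteq> 0"
    using assms unfolding spine_pos_def spine_depth_def shared_def prod.case ab by simp_all
  have proj: "?p h = ?p h'"
    using pos by (auto simp: star_dist_def star_proj_def split: if_splits)
  show ?thesis
  proof (cases "star_dist h (?p h) = 0")
    case True
    then show ?thesis using depth(1) proj by (simp add: star_dist_def split: if_splits)
  next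
    case False
    with depth have *: "star_dist h (?p h) = 1" "star_dist h' (?p h') = 1" by linarith+
    with sh have "a = b" "b \<noteq> 0" by blast+
    then have "star_dist x (?p x) \<noteq> 1" if "x \<noteq> 0" for x
      using that by (cases "x = b") (simp_all add: star_dist_def star_proj_def)
    with * show ?thesis by metis
  qed
qed

text \<open>Copy \<open>i\<close> ends on the spine at \<open>g (Suc i)\<close>, and copy
  \<open>Suc i\<close> begins at \<open>g i\<close>. Values of \<open>g\<close> outside the path are
  arbitrary and merely give the two end copies a fictitious entry or exit.\<close>

lemma spine_connecting_edge:
  "spine_pos g (Suc i, g i) = Suc (spine_pos g (i, g (Suc i)))"
  "spine_depth g (Suc i, g i) = 0" "spine_depth g (i, g (Suc i)) = 0"
  by (auto simp: spine_pos_def spine_depth_def spine_start_Suc star_dist_def star_proj_def)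

lemma spine_depth_center: "spine_depth g (i, 0) = (if shared g i then 1 else 0)"
  by (simp add: spine_depth_def shared_def star_dist_def star_proj_def)

lemma spine_star_edge:
  assumes "h \<noteq> 0"
  shows "spine_pos g (i, h) = spine_pos g (i, 0) \<and>
      (spine_depth g (i, h) = Suc (spine_depth g (i, 0)) \<or> spine_depth g (i, 0) = Suc (spine_depth g (i, h)))
    \<or> spine_depth g (i, h) = 0 \<and> spine_depth g (i, 0) = 0 \<and>
      (spine_pos g (i, h) = Suc (spine_pos g (i, 0)) \<or> spine_pos g (i, 0) = Suc (spine_pos g (i, h)))"
  using assms by (auto simp: spine_pos_def spine_depth_def star_dist_def star_proj_def)

lemma spine_arc:
  assumes "(u, v) \<in> parcs (path_star m n g)"
  shows "spine_pos g u = spine_pos g v \<and>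
      (spine_depth g u = Suc (spine_depth g v) \<or> spine_depth g v = Suc (spine_depth g u))
    \<or> spine_depth g u = 0 \<and> spine_depth g v = 0 \<and>
      (spine_pos g u = Suc (spine_pos g v) \<or> spine_pos g v = Suc (spine_pos g u))"
proof -
  obtain i h j h' where uv: "u = (i, h)" "v = (j, h')" by (metis prod.exhaust)
  show ?thesis
    using assms[unfolded uv arc_path_star_iff] spine_star_edge[of h g i] spine_star_edge[of h' g i]
      spine_connecting_edge[of g i] spine_connecting_edge[of g j]
    unfolding uv by auto
qed

text \<open>The potential is the position, plus the depth from a threshold on and minus the depth
  below it. The change of sign does no harm because arcs change the position only at depth 0. With
  the larger of the two positions as threshold, both depths are added to the distance.\<close>

lemma graph_dist_ge_spine:
  assumes pg: "pair_graph (path_star m n g)" and "spine_pos g u \<noteq> spine_pos g v"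
  shows "graph_dist (path_star m n g) u v \<ge>
    ereal (real_of_int (\<bar>int (spine_pos g u) - int (spine_pos g v)\<bar>
      + int (spine_depth g u) + int (spine_depth g v)))"
proof -
  define \<psi> :: "nat \<Rightarrow> nat \<times> nat \<Rightarrow> int" where
    "\<psi> = (\<lambda>a w. int (spine_pos g w) +
      (if a \<le> spine_pos g w then int (spine_depth g w) else - int (spine_depth g w)))"
  have \<psi>: "\<psi> a x \<le> \<psi> a y + 1" "\<psi> a y \<le> \<psi> a x + 1"
    if "(x, y) \<in> parcs (path_star m n g)" for a x y
    using spine_arc[OF that] by (auto simp: \<psi>_def)
  show ?thesis
  proof (cases "spine_pos g u < spine_pos g v")
    case True
    show ?thesis
    proof (rule graph_dist_ge_Lipschitz[OF pg, of "\<lambda>w. - \<psi> (spine_pos g v) w"])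
      show "- \<psi> (spine_pos g v) a \<le> - \<psi> (spine_pos g v) b + 1"
        if "(a, b) \<in> parcs (path_star m n g)" for a b
        using \<psi>(2)[OF that, of "spine_pos g v"] by simp
    qed (use True in \<open>simp add: \<psi>_def\<close>)
  next
    case False
    show ?thesis
    proof (rule graph_dist_ge_Lipschitz[OF pg, of "\<psi> (spine_pos g u)"])
      show "\<psi> (spine_pos g u) a \<le> \<psi> (spine_pos g u) b + 1"
        if "(a, b) \<in> parcs (path_star m n g)" for a b
        using \<psi>(1)[OF that] .
    qed (use False assms(2) in \<open>simp add: \<psi>_def\<close>)
  qed
qed

lemma packing_coloring_9_path_star:
  assumes "f \<in> {1..m} \<rightarrow> {0..n}"
  shows "\<exists>c. packing_coloring (path_star m n f) 9 c"
proof -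
  note pg = pair_graph_path_star[OF assms]
  define c where "c u = spine_color (shared f (fst u)) (spine_depth f u) (spine_pos f u)" for u
  have "packing_coloring (path_star m n f) 9 c"
    unfolding packing_coloring_def
  proof (intro conjI ballI impI; (elim conjE)?)
    show "c \<in> pverts (path_star m n f) \<rightarrow> {1..9}" using spine_color_bounds by (auto simp: c_def simp flip: One_nat_def)
    fix u v assume "u \<noteq> v" and eq: "c u = c v"
    obtain i h j h' where uv: "u = (i, h)" "v = (j, h')" by (metis prod.exhaust)
    show "ereal (real (c u)) < graph_dist (path_star m n f) u v"
    proof (cases "c u \<ge> 2")
      case True
      \<comment> \<open>Positions increase strictly from copy to copy, so equal positions force a
        common copy, where colour and position determine the vertex.\<close>
      have pos: "spine_pos f u \<noteq> spine_pos f v"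
      proof
        assume eqp: "spine_pos f u = spine_pos f v"
        then have ij: "i = j"
          using spine_pos_less[of i j f h h'] spine_pos_less[of j i f h' h] uv
          by (metis less_irrefl linorder_neqE_nat)
        have "spine_color (shared f i) (spine_depth f u) (spine_pos f u)
            = spine_color (shared f i) (spine_depth f v) (spine_pos f u)"
          "2 \<le> spine_color (shared f i) (spine_depth f u) (spine_pos f u)"
          using eq True eqp ij uv by (simp_all add: c_def)
        note depth = spine_color_eq_depth[OF this]
        have "h = h'"
          using eqp depth unfolding uv ij by (rule spine_coordinates_inj)
        with ij uv \<open>u \<noteq> v\<close> show False by simp
      qed
      have "int (c u) < \<bar>int (spine_pos f u) - int (spine_pos f v)\<bar>
          + int (spine_depth f u) + int (spine_depth f v)"
      proof (cases "spine_pos f u < spine_pos f v")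
        case lt: True
        have "c u < spine_pos f v - spine_pos f u + spine_depth f u + spine_depth f v"
          by (rule spine_color_packing[OF _ _ True lt]) (use eq in \<open>simp_all add: c_def\<close>)
        with lt show ?thesis by linarith
      next
        case False
        with pos have lt: "spine_pos f v < spine_pos f u" by linarith
        have "c u < spine_pos f u - spine_pos f v + spine_depth f v + spine_depth f u"
          by (rule spine_color_packing[OF _ _ True lt]) (use eq in \<open>simp_all add: c_def\<close>)
        with lt show ?thesis by linarith
      qed
      then have "ereal (real (c u)) < ereal (real_of_int (\<bar>int (spine_pos f u) - int (spine_pos f v)\<bar>
          + int (spine_depth f u) + int (spine_depth f v)))"
        by (metis less_ereal.simps(1) of_int_less_iff of_int_of_nat_eq)
      also have "\<dots> \<le> graph_dist (path_star m n f) u v"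
        by (rule graph_dist_ge_spine[OF pg pos])
      finally show ?thesis .
    next
      case False
      with eq have col: "c u = 1" "c v = 1"
        using spine_color_bounds(1)[of "shared f (fst u)" "spine_depth f u" "spine_pos f u"]
        unfolding c_def by linarith+
      \<comment> \<open>Colour 1 is independent: a star edge contains a centre, which never has
        colour 1, and a connecting edge joins spine vertices at consecutive positions, of which only
        the odd one can have it.\<close>
      have center: "c (i', 0) \<noteq> 1" for i'
        using line_color_bounds(1)[of "spine_pos f (i', 0)"]
        by (simp add: c_def spine_color_def spine_depth_center)
      have on_spine: "odd (spine_pos f x)" if "c x = 1" "spine_depth f x = 0" for x
        using that line_color_bounds(1)[of "spine_pos f x"] 
        by (simp add: c_def spine_color_def split: if_splits)
      have conn: "\<not> (c (Suc i', f i') = 1 \<and> c (i', f (Suc i')) = 1)" for i'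
        using on_spine[of "(Suc i', f i')"] on_spine[of "(i', f (Suc i'))"]
          spine_connecting_edge[of f i'] by auto
      have "(u, v) \<notin> parcs (path_star m n f)"
      proof
        assume "(u, v) \<in> parcs (path_star m n f)"
        then show False
          using col center[of i] center[of j] conn[of i] conn[of j] unfolding uv arc_path_star_iff by auto
      qed
      then show ?thesis
        using graph_dist_gt_1[OF pg \<open>u \<noteq> v\<close>] col by simp
    qed
  qed
  then show ?thesis by blast
qed

section \<open>Lower bounds on the upper number\<close>

definition packing_word :: "nat \<Rightarrow> nat \<Rightarrow> (nat \<Rightarrow> nat) \<Rightarrow> bool" where
  "packing_word k l s \<longleftrightarrow> (\<forall>i<l. s i \<in> {2..k}) \<and>
     (\<forall>i<l. \<forall>j<l. i < j \<and> s i = s j \<longrightarrow> s i < j - i)"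

lemma packing_word_range: "packing_word k l s \<Longrightarrow> i < l \<Longrightarrow> 2 \<le> s i \<and> s i \<le> k"
  by (simp add: packing_word_def)

lemma packing_word_gap: "packing_word k l s \<Longrightarrow> i < j \<Longrightarrow> j < l \<Longrightarrow> s i = s j \<Longrightarrow> s i < j - i"
  by (simp add: packing_word_def)

lemma packing_word_rev:
  assumes "packing_word k l s"
  shows "packing_word k l (\<lambda>i. s (l - 1 - i))"
  unfolding packing_word_def
proof (intro conjI allI impI; (elim conjE)?)
  show "s (l - 1 - i) \<in> {2..k}" if "i < l" for i
    using assms that by (simp add: packing_word_def)
  show "s (l - 1 - i) < j - i"
    if "i < l" "j < l" "i < j" "s (l - 1 - i) = s (l - 1 - j)" for i j
  proof -
    have "l - 1 - j < l - 1 - i" "l - 1 - i < l" "l - 1 - j < l" using that by linarith+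
    with assms that(4) have "s (l - 1 - j) < (l - 1 - i) - (l - 1 - j)"
      unfolding packing_word_def by metis
    with that show ?thesis by linarith
  qed
qed

text \<open>The list holds the letters read so far, the most recent first.\<close>

fun extendable :: "nat \<Rightarrow> nat \<Rightarrow> nat \<Rightarrow> nat list \<Rightarrow> bool" where
  "extendable k b 0 w = (hd w \<noteq> b)"
| "extendable k b (Suc l) w =
    (\<exists>a \<in> set [2..<Suc k]. a \<notin> set (take a w) \<and> extendable k b l (a # w))"

declare extendable.simps [simp del]

text \<open>A word is a successful run of the search that starts from its own prefix. The prefix has
  length \<open>Suc p\<close>, hence is never empty and \<open>hd\<close> is meaningful.\<close>

lemma extendable_if_packing_word:
  assumes "packing_word k (Suc p + l) s" "s (p + l) \<noteq> b"
  shows "extendable k b l (rev (map s [0..<Suc p]))"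
  using assms
proof (induction l arbitrary: p)
  case (Suc l)
  have "s (Suc p) \<in> {2..k}"
    using Suc.prems(1) by (simp add: packing_word_def)
  then have "s (Suc p) \<in> set [2..<Suc k]" by (simp add: less_Suc_eq_le del: upt_Suc)
  moreover have "s (Suc p) \<notin> set (take (s (Suc p)) (rev (map s [0..<Suc p])))"
  proof
    assume "s (Suc p) \<in> set (take (s (Suc p)) (rev (map s [0..<Suc p])))"
    then obtain q where q: "q < s (Suc p)" "q < Suc p" "rev (map s [0..<Suc p]) ! q = s (Suc p)"
      by (auto simp: in_set_conv_nth simp del: upt_Suc)
    then have sq: "s (p - q) = s (Suc p)"
      by (simp add: rev_nth del: upt_Suc)
    then have "s (p - q) < Suc p - (p - q)"
      by (intro packing_word_gap[OF Suc.prems(1)]) auto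
    with q sq show False by linarith
  qed
  moreover have "extendable k b l (s (Suc p) # rev (map s [0..<Suc p]))"
    using Suc.IH[of "Suc p"] Suc.prems by simp
  ultimately show ?case by (auto simp: extendable.simps simp del: upt_Suc)
qed (simp add: extendable.simps)

text \<open>The search is started from every first letter except 2 and rejects the final letter
  \<open>b\<close>; if all runs fail, one of the two ends must be as stated.\<close>

lemma packing_word_first_or_last:
  assumes "packing_word k (Suc l) s" "list_all (\<lambda>a. \<not> extendable k b l [a]) [3..<Suc k]"
  shows "s 0 = 2 \<or> s l = b"
proof (rule ccontr)
  assume "\<not> ?thesis"
  then have "extendable k b l [s 0]" "s 0 \<in> set [3..<Suc k]"
    using extendable_if_packing_word[of k 0 l s b] assms(1) by (force simp: packing_word_def)+
  with assms(2) show False by (auto simp: list_all_iff)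
qed

lemma packing_word_5_9: "packing_word 5 9 s \<Longrightarrow> s 0 = 2"
  and packing_word_5_8: "packing_word 5 8 s \<Longrightarrow> s 0 = 2 \<or> s 7 = 2"
proof -
  \<comment> \<open>Since 0 is never a letter, \<open>b = 0\<close> puts no condition on the last
    letter.\<close>
  have "list_all (\<lambda>a. \<not> extendable 5 0 8 [a]) [3..<Suc 5]" by code_simp
  then show "s 0 = 2" if "packing_word 5 9 s"
    using packing_word_first_or_last[of 5 8 s 0] packing_word_range[OF that, of 8] that
    by simp
  have "list_all (\<lambda>a. \<not> extendable 5 2 7 [a]) [3..<Suc 5]" by code_simp
  then show "packing_word 5 8 s \<Longrightarrow> s 0 = 2 \<or> s 7 = 2"
    using packing_word_first_or_last[of 5 7 s 2] by simp
qed

lemma packing_word_6_34: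
  assumes "packing_word 6 34 s"
  shows "s 0 = 2"
proof -
  have "list_all (\<lambda>a. \<not> extendable 6 0 33 [a]) [3..<Suc 6]" by code_simp
  then show ?thesis
    using packing_word_first_or_last[of 6 33 s 0] packing_word_range[OF assms, of 33] assms by simp
qed

lemma packing_word_6_33:
  assumes "packing_word 6 33 s"
  shows "s 0 = 2 \<or> s 32 = 2"
proof -
  have "list_all (\<lambda>a. \<not> extendable 6 2 32 [a]) [3..<Suc 6]" by code_simp
  then show ?thesis
    using packing_word_first_or_last[of 6 32 s 2] assms by simp
qed

section \<open>Colourings of the caterpillar given by the zero function\<close>

locale caterpillar_coloring =
  fixes m n k :: nat and f :: "nat \<Rightarrow> nat" and c :: "nat \<times> nat \<Rightarrow> nat"
  assumes f: "\<And>i. i \<in> {1..m} \<Longrightarrow> f i = 0"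
    and c: "packing_coloring (path_star m n f) k c"
    and k: "k \<le> n + 2"
begin

abbreviation "R \<equiv> parcs (path_star m n f)"

lemma pg: "pair_graph (path_star m n f)"
  using f by (intro pair_graph_path_star) auto

lemma arc_star: "i \<in> {1..m} \<Longrightarrow> h \<in> {1..n} \<Longrightarrow> ((i, h), (i, 0)) \<in> R"
  by (auto simp: arc_path_star_iff)

lemma arc_centers: "i \<in> {1..m} \<Longrightarrow> j \<in> {1..m} \<Longrightarrow> j = Suc i \<or> i = Suc j \<Longrightarrow> ((i, 0), (j, 0)) \<in> R"
  using f by (auto simp: arc_path_star_iff)

lemma color_range: "i \<in> {1..m} \<Longrightarrow> h \<le> n \<Longrightarrow> c (i, h) \<in> {1..k}"
  using c by (auto simp: packing_coloring_def pverts_path_star Pi_iff)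

lemma color_neq:
  assumes "(u, v) \<in> R ^^ l" "u \<noteq> v" "u \<in> {1..m} \<times> {0..n}" "v \<in> {1..m} \<times> {0..n}" "l \<le> c u"
  shows "c u \<noteq> c v"
  using packing_coloring_neq[OF c pg _ _ assms(2,1,5)] assms(3,4) by (simp add: pverts_path_star)

lemma color_adjacent:
  assumes "(u, v) \<in> R"
  shows "c u \<noteq> c v"
proof -
  have "u \<noteq> v" using assms by (cases u; cases v) (auto simp: arc_path_star_iff)
  moreover have uv: "u \<in> {1..m} \<times> {0..n}" "v \<in> {1..m} \<times> {0..n}"
    using assms f by (cases u; cases v; auto simp: arc_path_star_iff)+
  moreover have "1 \<le> c u" using uv(1) color_range by (cases u) auto
  ultimately show ?thesis using color_neq[of u v 1] assms by simp
qed

lemma centers_relpow: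
  assumes "1 \<le> i" "i \<le> j" "j \<le> m"
  shows "((i, 0), (j, 0)) \<in> R ^^ (j - i)"
  using assms(2,3)
proof (induction j rule: dec_induct)
  case (step j)
  then have "((j, 0), (Suc j, 0)) \<in> R" using assms(1) by (intro arc_centers) auto
  moreover have "Suc j - i = Suc (j - i)" using step by simp
  ultimately show ?case using step by auto
qed simp

lemma packing_word_centers:
  assumes "a + l \<le> m" "\<And>i. i < l \<Longrightarrow> c (Suc (a + i), 0) \<noteq> 1"
  shows "packing_word k l (\<lambda>i. c (Suc (a + i), 0))"
  unfolding packing_word_def
proof (intro conjI allI impI; (elim conjE)?)
  show "c (Suc (a + i), 0) \<in> {2..k}" if "i < l" for i
    using color_range[of "Suc (a + i)" 0] assms that by fastforce
  show "c (Suc (a + i), 0) < j - i"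
    if "i < l" "j < l" "i < j" "c (Suc (a + i), 0) = c (Suc (a + j), 0)" for i j
  proof (rule ccontr)
    assume "\<not> c (Suc (a + i), 0) < j - i"
    then show False
      using color_neq[of "(Suc (a + i), 0)" "(Suc (a + j), 0)" "j - i"]
        centers_relpow[of "Suc (a + i)" "Suc (a + j)"] that assms(1) by auto
  qed
qed

text \<open>Neighbours of a vertex of colour 1 avoid colour 1 and are pairwise within distance 2, so
  no colour can repeat among them.\<close>

lemma neighbours_of_color_1:
  assumes "c v = 1" "\<And>x. x \<in> N \<Longrightarrow> (x, v) \<in> R"
  shows "inj_on c N" "c ` N \<subseteq> {2..k}"
proof -
  have verts: "x \<in> {1..m} \<times> {0..n}" if "x \<in> N" for x
    using assms(2)[OF that] f by (cases x; cases v) (auto simp: arc_path_star_iff)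
  have ran: "c x \<in> {2..k}" if "x \<in> N" for x
    using verts[OF that] color_range[of "fst x" "snd x"] color_adjacent[OF assms(2)[OF that]] assms(1)
    by (cases x) fastforce
  then show "c ` N \<subseteq> {2..k}" by blast
  show "inj_on c N"
  proof (rule inj_onI, rule ccontr)
    fix x y assume xy: "x \<in> N" "y \<in> N" "c x = c y" "x \<noteq> y"
    have "(x, y) \<in> R ^^ 2"
      using assms(2)[OF xy(1)] arc_path_star_sym[OF assms(2)[OF xy(2)]]
      by (auto simp: numeral_2_eq_2)
    moreover have "2 \<le> c x" using ran[OF xy(1)] by simp
    ultimately show False using color_neq xy verts by metis
  qed
qed

text \<open>An inner centre has \<open>n + 2\<close> neighbours, but by \<open>k \<le> n + 2\<close>
  only at most \<open>n + 1\<close> colours other than 1 exist.\<close>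

lemma inner_center_color:
  assumes "2 \<le> i" "i < m"
  shows "c (i, 0) \<noteq> 1"
proof
  assume 1: "c (i, 0) = 1"
  obtain j where j: "i = Suc j" "1 \<le> j" using assms(1) by (cases i) auto
  let ?N = "insert (j, 0) (insert (Suc i, 0) (Pair i ` {1..n}))"
  have N: "(x, (i, 0)) \<in> R" if "x \<in> ?N" for x
    using that assms j arc_centers[of j i] arc_centers[of "Suc i" i] arc_star[of i] by auto
  have "inj_on c ?N" by (rule neighbours_of_color_1(1)[OF 1 N])
  moreover have "c ` ?N \<subseteq> {2..k}" by (rule neighbours_of_color_1(2)[OF 1 N])
  ultimately have "card ?N \<le> card {2..k}" by (rule card_inj_on_le) simp
  moreover have "card ?N = n + 2"
    using j by (auto simp: card_insert_if card_image inj_on_def)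
  ultimately show False using k by simp
qed

text \<open>Now the count is tight: the \<open>n + 1\<close> listed neighbours of
  \<open>(i, 0)\<close> use up all of \<open>{2..k}\<close>. Hence one of them has the colour of
  \<open>(w, 0)\<close>. It is not \<open>(z, 0)\<close>, so it is a leaf at distance at most 3 from
  \<open>(w, 0)\<close>, and the common colour can only be 2. This bars 2 from
  \<open>(z, 0)\<close>.\<close>

lemma end_center_color:
  assumes i: "i \<in> {1..m}" "c (i, 0) = 1"
    and z: "z \<in> {1..m}" "z = Suc i \<or> i = Suc z"
    and w: "2 \<le> w" "w < m" "w = Suc z \<or> z = Suc w" "w \<noteq> i"
  shows "c (z, 0) \<noteq> 2"
proof -
  let ?N = "insert (z, 0) (Pair i ` {1..n})"
  have arcs: "(x, (i, 0)) \<in> R" if "x \<in> ?N" for x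
    using that z(2) arc_centers[OF z(1) i(1)] arc_star[OF i(1)] by auto
  have inj: "inj_on c ?N" by (rule neighbours_of_color_1(1)[OF i(2) arcs])
  have sub: "c ` ?N \<subseteq> {2..k}" by (rule neighbours_of_color_1(2)[OF i(2) arcs])
  have "card ?N = n + 1"
    using z(2) by (auto simp: card_insert_if card_image inj_on_def)
  then have "card {2..k} \<le> card (c ` ?N)"
    using k by (simp only: card_image[OF inj]) simp
  then have "c ` ?N = {2..k}" by (intro card_seteq sub) simp_all
  moreover have "c (w, 0) \<in> {2..k}"
    using color_range[of w 0] inner_center_color[of w] w by fastforce
  ultimately obtain x where x: "x \<in> ?N" "c x = c (w, 0)" by (metis imageE)
  have zw: "((z, 0), (w, 0)) \<in> R" using z(1) w by (intro arc_centers) auto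
  then have "x \<noteq> (z, 0)" using color_adjacent x(2) by metis
  then obtain h where h: "h \<in> {1..n}" "x = (i, h)" using x(1) by auto
  have "((i, h), (w, 0)) \<in> R ^^ 3"
    using arc_star[OF i(1) h(1)] arc_centers[OF i(1) z] zw by (auto simp: numeral_3_eq_3)
  then have "\<not> 3 \<le> c x"
    using color_neq[of "(i, h)" "(w, 0)" 3] h x(2) i(1) w by auto
  moreover have "c x \<in> {2..k}" using sub x(1) by blast
  ultimately have "c (w, 0) = 2" using x(2) by simp
  then show ?thesis using color_adjacent[OF zw] by simp
qed

text \<open>Centres 2 to \<open>l + 1\<close> are inner, so \<open>short\<close> puts a 2 on one of
  these two. If it is on centre 2, then centre 1 is not coloured 1, so \<open>long\<close> puts a 2
  on it too, next to the other. If centre 2 is not coloured 2, then centre \<open>l + 1\<close> is,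
  so centre \<open>l + 2\<close> is not coloured 1 and \<open>long\<close> puts a 2 on centre 2
  after all.\<close>

lemma caterpillar_not_colorable:
  assumes "3 \<le> l" "l + 2 \<le> m"
    and long: "\<And>s. packing_word k (Suc l) s \<Longrightarrow> s 0 = 2"
    and short: "\<And>s. packing_word k l s \<Longrightarrow> s 0 = 2 \<or> s (l - 1) = 2"
  shows False
proof -
  have inner: "c (Suc i, 0) \<noteq> 1" if "1 \<le> i" "i \<le> l" for i
    using that assms(1,2) by (intro inner_center_color) auto
  have adj: "c (1, 0) \<noteq> c (2, 0)"
    using assms(1,2) by (intro color_adjacent arc_centers) auto
  have first: "c (2, 0) \<noteq> 2" if "c (1, 0) = 1"
    using that assms(1,2) end_center_color[of 1 2 3] by auto
  have last: "c (l + 1, 0) \<noteq> 2" if "c (l + 2, 0) = 1"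
  proof -
    \<comment> \<open>A centre of colour 1 cannot be inner, so this one must be the end of the
      path.\<close>
    have "m = l + 2" using that inner_center_color[of "l + 2"] assms(2) by fastforce
    then show ?thesis using that assms(1,2) end_center_color[of "l + 2" "l + 1" l] by auto
  qed
  have word1: "c (1, 0) = 2 \<and> c (l + 1, 0) = 2" if "c (1, 0) \<noteq> 1"
  proof -
    have "c (Suc (0 + i), 0) \<noteq> 1" if "i < Suc l" for i
      using inner[of i] that \<open>c (1, 0) \<noteq> 1\<close> by (cases "i = 0") auto
    then have "packing_word k (Suc l) (\<lambda>i. c (Suc (0 + i), 0))"
      using assms(2) by (intro packing_word_centers) auto
    from long[OF this] long[OF packing_word_rev[OF this]] show ?thesis by simp
  qed
  have word2: "c (2, 0) = 2" if "c (l + 2, 0) \<noteq> 1"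
  proof -
    have "c (Suc (1 + i), 0) \<noteq> 1" if "i < Suc l" for i
      using inner[of "Suc i"] that \<open>c (l + 2, 0) \<noteq> 1\<close> by (cases "i = l") auto
    then have "packing_word k (Suc l) (\<lambda>i. c (Suc (1 + i), 0))"
      using assms(2) by (intro packing_word_centers) auto
    from long[OF this] show ?thesis by (simp add: numeral_2_eq_2)
  qed
  have "packing_word k l (\<lambda>i. c (Suc (1 + i), 0))"
    using inner assms(2) by (intro packing_word_centers) auto
  from short[OF this] have "c (2, 0) = 2 \<or> c (l + 1, 0) = 2"
    using assms(1) by (simp add: numeral_2_eq_2)
  then show False using adj first last word1 word2 by metis
qed

end

section \<open>From colourings to the minimum and maximum over all functions\<close>

lemma sierpinski_packing_values_path_star:
  "sierpinski_packing_values (path_graph m) (star_graph n) =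
    (\<lambda>f. packing_chromatic_number (path_star m n f)) ` ({1..m} \<rightarrow>\<^sub>E {0..n})"
  by (simp add: sierpinski_packing_values_def path_graph_def star_graph_def)

lemma finite_pverts_path_star: "finite (pverts (path_star m n f))"
  by (simp add: pverts_path_star)

lemma upper_sierpinski_packing_number_gt:
  assumes "k \<le> n + 2" "3 \<le> l" "l + 2 \<le> m"
    and "\<And>s. packing_word k (Suc l) s \<Longrightarrow> s 0 = 2"
    and "\<And>s. packing_word k l s \<Longrightarrow> s 0 = 2 \<or> s (l - 1) = 2"
  shows "k < upper_sierpinski_packing_number (path_graph m) (star_graph n)"
proof -
  define f :: "nat \<Rightarrow> nat" where "f = (\<lambda>i\<in>{1..m}. 0)"
  have "\<not> packing_coloring (path_star m n f) k c" for c
  proof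
    assume "packing_coloring (path_star m n f) k c"
    then interpret caterpillar_coloring m n k f c
      by unfold_locales (use assms(1) in \<open>simp_all add: f_def\<close>)
    show False by (rule caterpillar_not_colorable[of l]) (fact assms)+
  qed
  then have "k < packing_chromatic_number (path_star m n f)"
    by (intro packing_chromatic_number_gt finite_pverts_path_star)
  also have "\<dots> \<le> upper_sierpinski_packing_number (path_graph m) (star_graph n)"
    unfolding upper_sierpinski_packing_number_def
  proof (rule Max_ge)
    show "finite (sierpinski_packing_values (path_graph m) (star_graph n))"
      by (rule finite_sierpinski_packing_values[OF pair_graph_path_graph pair_graph_star_graph])
        (simp add: star_graph_def)
    show "packing_chromatic_number (path_star m n f) \<in> sierpinski_packing_values (path_graph m) (star_graph n)"
      unfolding sierpinski_packing_values_path_star by (rule imageI) (auto simp: f_def)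
  qed
  finally show ?thesis .
qed

theorem theorem4p6:
  fixes m n :: nat
  assumes "m \<ge> 2" and "n \<ge> 3"
  shows "sierpinski_packing_number (path_graph m) (star_graph n) = 3 \<and>
    upper_sierpinski_packing_number (path_graph m) (star_graph n) \<le> 9 \<and>
    (n = 3 \<and> m \<ge> 10 \<longrightarrow>
      upper_sierpinski_packing_number (path_graph m) (star_graph n) \<in> {6, 7, 8, 9}) \<and>
    (n > 3 \<and> m \<ge> 35 \<longrightarrow>
      upper_sierpinski_packing_number (path_graph m) (star_graph n) \<in> {7, 8, 9})"
proof -
  let ?V = "sierpinski_packing_values (path_graph m) (star_graph n)"
  let ?u = "upper_sierpinski_packing_number (path_graph m) (star_graph n)"
  have "pverts (star_graph n) \<noteq> {}" by (simp add: star_graph_def)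
  note V = finite_sierpinski_packing_values[OF pair_graph_path_graph[of m] pair_graph_star_graph this]
    sierpinski_packing_values_nonempty[OF pair_graph_path_graph[of m] pair_graph_star_graph this]
  have ge3: "3 \<le> v" if v: "v \<in> ?V" for v
  proof -
    obtain f where f: "f \<in> {1..m} \<rightarrow>\<^sub>E {0..n}" "v = packing_chromatic_number (path_star m n f)"
      using v unfolding sierpinski_packing_values_path_star by blast
    then have "2 < v"
      using no_packing_coloring_2_path_star[of m n f] assms
      by (auto intro!: packing_chromatic_number_gt finite_pverts_path_star simp: PiE_iff Pi_iff)
    then show ?thesis by simp
  qed
  obtain f c where f: "f \<in> {1..m} \<rightarrow>\<^sub>E {0..n}" and c: "packing_coloring (path_star m n f) 3 c"
    using packing_coloring_3_path_star[of n m] assms(2) by auto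
  have fV: "packing_chromatic_number (path_star m n f) \<in> ?V"
    unfolding sierpinski_packing_values_path_star using f by (rule imageI)
  then have "packing_chromatic_number (path_star m n f) = 3"
    using packing_chromatic_number_le[OF c] ge3 by (simp add: order_antisym)
  with fV have "3 \<in> ?V" by simp
  then have lower: "sierpinski_packing_number (path_graph m) (star_graph n) = 3"
    unfolding sierpinski_packing_number_def using V(1) ge3 by (intro Min_eqI) auto
  have le9: "?u \<le> 9"
    unfolding upper_sierpinski_packing_number_def
  proof (rule Max.boundedI[OF V])
    fix v assume "v \<in> ?V"
    then obtain f where "f \<in> {1..m} \<rightarrow>\<^sub>E {0..n}" "v = packing_chromatic_number (path_star m n f)"
      unfolding sierpinski_packing_values_path_star by blast
    then show "v \<le> 9"
      using packing_coloring_9_path_star[of f m n] packing_chromatic_number_le by (auto simp: PiE_iff Pi_iff)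
  qed
  \<comment> \<open>The condition \<open>k \<le> n + 2\<close> admits \<open>k = 5\<close> for
    \<open>n = 3\<close> and \<open>k = 6\<close> from \<open>n = 4\<close> on; the bounds 10 and 35
    on \<open>m\<close> are \<open>l + 2\<close> for \<open>l = 8\<close> and
    \<open>l = 33\<close>.\<close>
  have "5 < ?u" if "m \<ge> 10"
    using upper_sierpinski_packing_number_gt[of 5 n 8 m] packing_word_5_9 packing_word_5_8 assms(2) that
    by simp
  moreover have "6 < ?u" if "n > 3" "m \<ge> 35"
    using upper_sierpinski_packing_number_gt[of 6 n 33 m] packing_word_6_34 packing_word_6_33 that
    by simp
  ultimately show ?thesis using lower le9 by fastforce
qed

end
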